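(* For any $A,B,B',C'\in\widehat{\mathbb{F}_q}$, any $x\in\mathbb{F}_q\setminus\{1\}$ and any $y\in\mathbb{F}_q$, $$F_{2}(A;B,B';B,C';x,y)=-\varepsilon(x)\,\overline{A}(1-x)\,{}_{2}F_1\left(\begin{matrix}A,B'\\ C'\end{matrix}\bigg|\,\frac{y}{1-x}\right)+\overline{B}(x)\binom{A\overline{B}}{\overline{B}}\,{}_{2}F_1\left(\begin{matrix}A\overline{B},B'\\ C'\end{matrix}\bigg|\,y\right)$$ $$\qquad+(q-1)\,\delta(A\overline{B})\,\overline{A}(-x)\,\overline{C'}(y)\,\overline{B'}C'(1-y).$$
   Context: Let $q$ be a power of a prime, $\mathbb{F}_q$ the field with $q$ elements, and $\widehat{\mathbb{F}_q}$ the group of (complex-valued) multiplicative characters of $\mathbb{F}_q^*$. Every character $\chi$, including the trivial character $\varepsilon$, is extended to $\mathbb{F}_q$ by $\chi(0)=0$. $\overline{\chi}$ denotes the inverse of $\chi$. Products of characters are evaluated pointwise, e.g. $\overline{B'}C'(1-y)=\overline{B'}(1-y)C'(1-y)$. For a character $\chi$, $\delta(\chi)=1$ if $\chi=\varepsilon$ and $\delta(\chi)=0$ otherwise. Jacobi sum: $J(\chi,\lambda)=\sum_{u\in\mathbb{F}_q}\chi(u)\lambda(1-u)$. Binomial coefficient of characters: $\binom{A}{B}=B(-1)J(A,\overline{B})$. Finite field ${}_2F_1$: for $A,B,C\in\widehat{\mathbb{F}_q}$ and $x\in\mathbb{F}_q$, $${}_{2}F_1\left(\begin{matrix}A,B\\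 C\end{matrix}\bigg|\,x\right)=\varepsilon(x)\,BC(-1)\sum_{u\in\mathbb{F}_q}B(u)\,\overline{B}C(1-u)\,\overline{A}(1-xu).$$ The finite field Appell series $F_2$ is defined, for $A,B,B',C,C'\in\widehat{\mathbb{F}_q}$ and $x,y\in\mathbb{F}_q$, by $$F_{2}(A;B,B';C,C';x,y)=\varepsilon(xy)\,BB'CC'(-1)\sum_{u,v\in\mathbb{F}_q}B(u)B'(v)\,\overline{B}C(1-u)\,\overline{B'}C'(1-v)\,\overline{A}(1-ux-vy).$$ *)

theory Defs
  imports Complex_Main "HOL-Library.Cardinality"
begin

text \<open>
  The field with \<open>q\<close> elements is a type of sort \<open>{field, finite}\<close>, with \<open>q = CARD('a)\<close>;
  that \<open>q\<close> is a prime power is then automatic, and every prime power is the cardinality of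
  such a type.
\<close>

text \<open>
  A multiplicative character is a group homomorphism from the nonzero elements to the nonzero
  complex numbers, extended by \<open>0\<close> at \<open>0\<close> (also when it is trivial).
\<close>

definition mult_chars :: "('a::{field,finite} \<Rightarrow> complex) set" where
  "mult_chars = {\<chi>. \<chi> 0 = 0 \<and> (\<forall>x. x \<noteq> 0 \<longrightarrow> \<chi> x \<noteq> 0) \<and>
                    (\<forall>x y. x \<noteq> 0 \<longrightarrow> y \<noteq> 0 \<longrightarrow> \<chi> (x * y) = \<chi> x * \<chi> y)}"

definition triv_char :: "'a::{field,finite} \<Rightarrow> complex" where
  "triv_char x = (if x = 0 then 0 else 1)"

definition char_mult ::
  "('a::{field,finite} \<Rightarrow> complex) \<Rightarrow> ('a \<Rightarrow> complex) \<Rightarrow> 'a \<Rightarrow> complex"  (infixl "\<cdot>" 70) where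
  "(\<chi> \<cdot> \<psi>) x = \<chi> x * \<psi> x"

text \<open>
  Since \<open>inverse 0 = 0\<close>, the pointwise inverse again vanishes at \<open>0\<close>.
\<close>

definition char_inv :: "('a::{field,finite} \<Rightarrow> complex) \<Rightarrow> 'a \<Rightarrow> complex" where
  "char_inv \<chi> x = inverse (\<chi> x)"

definition char_delta :: "('a::{field,finite} \<Rightarrow> complex) \<Rightarrow> complex" where
  "char_delta \<chi> = (if \<chi> = triv_char then 1 else 0)"

definition jacobi_sum ::
  "('a::{field,finite} \<Rightarrow> complex) \<Rightarrow> ('a \<Rightarrow> complex) \<Rightarrow> complex" where
  "jacobi_sum \<chi> \<psi> = (\<Sum>u\<in>UNIV. \<chi> u * \<psi> (1 - u))"

definition char_binom ::
  "('a::{field,finite} \<Rightarrow> complex) \<Rightarrow> ('a \<Rightarrow> complex) \<Rightarrow> complex" where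
  "char_binom A B = B (-1) * jacobi_sum A (char_inv B)"

definition hyp_2F1 ::
  "('a::{field,finite} \<Rightarrow> complex) \<Rightarrow> ('a \<Rightarrow> complex) \<Rightarrow> ('a \<Rightarrow> complex) \<Rightarrow> 'a \<Rightarrow> complex" where
  "hyp_2F1 A B C x =
     triv_char x * (B \<cdot> C) (-1) *
     (\<Sum>u\<in>UNIV. B u * (char_inv B \<cdot> C) (1 - u) * char_inv A (1 - x * u))"

definition appell_F2 ::
  "('a::{field,finite} \<Rightarrow> complex) \<Rightarrow> ('a \<Rightarrow> complex) \<Rightarrow> ('a \<Rightarrow> complex) \<Rightarrow>
   ('a \<Rightarrow> complex) \<Rightarrow> ('a \<Rightarrow> complex) \<Rightarrow> 'a \<Rightarrow> 'a \<Rightarrow> complex" where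
  "appell_F2 A B B' C C' x y =
     triv_char (x * y) * (B \<cdot> B' \<cdot> C \<cdot> C') (-1) *
     (\<Sum>u\<in>UNIV. \<Sum>v\<in>UNIV. B u * B' v * (char_inv B \<cdot> C) (1 - u) *
        (char_inv B' \<cdot> C') (1 - v) * char_inv A (1 - u * x - v * y))"

end

theory Submission
  imports Defs
begin

text \<open>
  When C = B the factor (char_inv B \<cdot> B) (1 - u) only removes the term u = 1 from the sum over u;
  the removed terms make up the first summand. In the completed inner sum over u put w = 1 - v * y.
  If w is nonzero, the substitution u = w * t / x gives a Jacobi sum times
  (B \<cdot> char_inv A) w, hence the second summand. If w = 0, i.e. v = 1 / y, orthogonality
  of characters gives the correction term with char_delta.
\<close>

lemma mult_chars_zero [simp]: "\<chi> \<in> mult_chars \<Longrightarrow> \<chi> 0 = 0"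
  by (simp add: mult_chars_def)

lemma mult_chars_eq_0_iff: "\<chi> \<in> mult_chars \<Longrightarrow> \<chi> x = 0 \<longleftrightarrow> x = 0"
  unfolding mult_chars_def by blast

text \<open>The definition asks for multiplicativity only at nonzero arguments. It extends to all
  arguments because a zero argument makes both sides 0.\<close>

lemma mult_chars_mult:
  assumes "\<chi> \<in> mult_chars"
  shows "\<chi> (x * y) = \<chi> x * \<chi> y"
proof (cases "x = 0 \<or> y = 0")
  case True
  then show ?thesis
    using mult_chars_zero[OF assms] by auto
next
  case False
  then show ?thesis
    using assms unfolding mult_chars_def by blast
qed

lemma mult_charsI:
  assumes "\<chi> 0 = 0" "\<And>x. x \<noteq> 0 \<Longrightarrow> \<chi> x \<noteq> 0" "\<And>x y. \<chi> (x * y) = \<chi> x * \<chi> y"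
  shows "\<chi> \<in> mult_chars"
  using assms unfolding mult_chars_def by blast

lemma mult_chars_one [simp]:
  assumes "\<chi> \<in> mult_chars"
  shows "\<chi> 1 = 1"
  using mult_chars_mult[OF assms, of 1 1] mult_chars_eq_0_iff[OF assms, of 1] by simp

text \<open>Valid at 0 as well, because \<open>inverse 0 = 0\<close> both in the finite field and in
  the complex numbers.\<close>

lemma mult_chars_inverse:
  assumes "\<chi> \<in> mult_chars"
  shows "\<chi> (inverse x) = inverse (\<chi> x)"
proof (cases "x = 0")
  case False
  then show ?thesis
    using mult_chars_mult[OF assms, of "inverse x" x] assms
    by (intro inverse_unique[symmetric]) (simp add: mult.commute)
qed (use assms in simp)

lemma mult_chars_divide: "\<chi> \<in> mult_chars \<Longrightarrow> \<chi> (x / y) = \<chi> x / \<chi> y"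
  by (simp add: divide_inverse mult_chars_mult mult_chars_inverse)

lemma mult_chars_minus_one_squared:
  assumes "\<chi> \<in> mult_chars"
  shows "\<chi> (-1) * \<chi> (-1) = 1"
  using mult_chars_mult[OF assms, of "-1" "-1"] assms by simp

lemma mult_chars_minus: "\<chi> \<in> mult_chars \<Longrightarrow> \<chi> (- x) = \<chi> (-1) * \<chi> x"
  using mult_chars_mult[of \<chi> "-1" x] by simp

lemma char_inv_mult_chars [simp]: "\<chi> \<in> mult_chars \<Longrightarrow> char_inv \<chi> \<in> mult_chars"
  by (rule mult_charsI) (simp_all add: char_inv_def mult_chars_eq_0_iff mult_chars_mult)

lemma char_mult_mult_chars [simp]:
  "\<chi> \<in> mult_chars \<Longrightarrow> \<psi> \<in> mult_chars \<Longrightarrow> \<chi> \<cdot> \<psi> \<in> mult_chars"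
  by (rule mult_charsI) (simp_all add: char_mult_def mult_chars_eq_0_iff mult_chars_mult mult_ac)

text \<open>The trivial character counts the nonzero elements. For any other \<open>\<chi>\<close>,
  some nonzero \<open>a\<close> has \<open>\<chi> a\<close> different from 1, and reindexing by
  multiplication with \<open>a\<close> multiplies the sum by \<open>\<chi> a\<close>, so the sum is
  0.\<close>

lemma sum_mult_char:
  fixes \<chi> :: "'a::{field,finite} \<Rightarrow> complex"
  assumes "\<chi> \<in> mult_chars"
  shows "(\<Sum>u\<in>UNIV. \<chi> u) = (of_nat CARD('a) - 1) * char_delta \<chi>"
proof (cases "\<chi> = triv_char")
  case True
  have "(\<Sum>u\<in>UNIV. \<chi> u) = (\<Sum>u\<in>UNIV - {0::'a}. 1)"
    by (intro sum.mono_neutral_cong_right) (auto simp: True triv_char_def)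
  also have "\<dots> = of_nat (CARD('a) - 1)"
    by (simp add: card_Diff_singleton)
  also have "\<dots> = of_nat CARD('a) - 1"
    by (subst of_nat_diff) (auto simp: Suc_le_eq card_gt_0_iff)
  finally show ?thesis
    by (simp add: char_delta_def True)
next
  case False
  then obtain a where a: "\<chi> a \<noteq> triv_char a"
    by blast
  with assms have a0: "a \<noteq> 0" and a1: "\<chi> a \<noteq> 1"
    by (auto simp: triv_char_def split: if_splits)
  have "(\<Sum>u\<in>UNIV. \<chi> u) = (\<Sum>u\<in>UNIV. \<chi> (a * u))"
    using a0 by (intro sum.reindex_bij_witness[of _ "\<lambda>u. a * u" "\<lambda>u. u / a"]) auto
  also have "\<dots> = \<chi> a * (\<Sum>u\<in>UNIV. \<chi> u)"
    by (simp add: mult_chars_mult[OF assms] sum_distrib_left)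
  finally show ?thesis
    using a1 False by (simp add: char_delta_def)
qed

text \<open>The map from \<open>u\<close> to \<open>t = 1 - 1/u\<close> carries the nonzero elements
  bijectively onto those different from 1, with \<open>1 - t = 1/u\<close> and
  \<open>t = - (1 - u) / u\<close>. The excluded terms on both sides vanish.\<close>

lemma jacobi_sum_transform:
  assumes A: "A \<in> mult_chars" and B: "B \<in> mult_chars"
  shows "jacobi_sum (A \<cdot> char_inv B) B = B (-1) * jacobi_sum B (char_inv A)"
proof -
  have "jacobi_sum (A \<cdot> char_inv B) B = (\<Sum>u\<in>UNIV - {0}. A u * inverse (B u) * B (1 - u))"
    unfolding jacobi_sum_def
    by (intro sum.mono_neutral_cong_right) (use A B in \<open>auto simp: char_mult_def char_inv_def\<close>)
  also have "\<dots> = (\<Sum>t\<in>UNIV - {1}. B (-1) * (B t * char_inv A (1 - t)))"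
  proof (rule sum.reindex_bij_witness[of _ "\<lambda>t. inverse (1 - t)" "\<lambda>u. 1 - inverse u"])
    fix u :: 'a
    assume u: "u \<in> UNIV - {0}"
    then have "1 - inverse u = - ((1 - u) / u)"
      by (simp add: field_simps)
    then have "B (1 - inverse u) = B (-1) * (B (1 - u) / B u)"
      using mult_chars_minus[OF B, of "(1 - u) / u"] by (simp add: mult_chars_divide[OF B])
    then show "B (-1) * (B (1 - inverse u) * char_inv A (1 - (1 - inverse u)))
        = A u * inverse (B u) * B (1 - u)"
      by (simp add: char_inv_def mult_chars_inverse[OF A] divide_inverse mult.assoc[symmetric]
          mult_chars_minus_one_squared[OF B])
  qed auto
  also have "\<dots> = (\<Sum>t\<in>UNIV. B (-1) * (B t * char_inv A (1 - t)))"
    by (intro sum.mono_neutral_left) (use A in \<open>auto simp: char_inv_def\<close>)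
  finally show ?thesis
    by (simp add: jacobi_sum_def sum_distrib_left)
qed

text \<open>Links the binomial coefficient of the theorem to the Jacobi sum produced by the sum over
  \<open>u\<close>: its sign \<open>char_inv B (-1)\<close> cancels the factor \<open>B (-1)\<close>
  of the transformation.\<close>

lemma char_binom_eq_jacobi_sum:
  assumes A: "A \<in> mult_chars" and B: "B \<in> mult_chars"
  shows "char_binom (A \<cdot> char_inv B) (char_inv B) = jacobi_sum B (char_inv A)"
proof -
  have "char_inv (char_inv B) = B"
    by (simp add: fun_eq_iff char_inv_def)
  moreover have "B (-1) \<noteq> 0"
    by (simp add: mult_chars_eq_0_iff[OF B])
  ultimately show ?thesis
    by (simp add: char_binom_def jacobi_sum_transform[OF A B] char_inv_def)
qed

text \<open>A single formula serves both cases: a character vanishes at 0, so the first summand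
  disappears exactly when the second may be present.\<close>

lemma sum_affine_char:
  fixes A B :: "'a::{field,finite} \<Rightarrow> complex"
  assumes A: "A \<in> mult_chars" and B: "B \<in> mult_chars" and x: "x \<noteq> 0"
  shows "(\<Sum>u\<in>UNIV. B u * char_inv A (w - u * x)) =
    char_inv B x * jacobi_sum B (char_inv A) * char_inv (A \<cdot> char_inv B) w
    + (if w = 0 then (of_nat CARD('a) - 1) * char_delta (A \<cdot> char_inv B) * char_inv A (- x) else 0)"
proof (cases "w = 0")
  case True
  have AB: "A \<cdot> char_inv B \<in> mult_chars"
    using A B by simp
  have "(\<Sum>u\<in>UNIV. B u * char_inv A (w - u * x))
      = (\<Sum>u\<in>UNIV. char_inv A (- x) * (A \<cdot> char_inv B) (inverse u))"
  proof (rule sum.cong)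
    fix u
    have "char_inv A (- (u * x)) = char_inv A u * char_inv A (- x)"
      using mult_chars_mult[OF char_inv_mult_chars[OF A], of u "- x"] by simp
    then show "B u * char_inv A (w - u * x) = char_inv A (- x) * (A \<cdot> char_inv B) (inverse u)"
      by (simp add: True char_mult_def char_inv_def mult_chars_inverse A B)
  qed simp
  also have "\<dots> = char_inv A (- x) * (\<Sum>u\<in>UNIV. (A \<cdot> char_inv B) (inverse u))"
    by (simp add: sum_distrib_left)
  \<comment> \<open>Inversion is an involution on the whole type, 0 included.\<close>
  also have "(\<Sum>u\<in>UNIV. (A \<cdot> char_inv B) (inverse u)) = (\<Sum>u\<in>UNIV. (A \<cdot> char_inv B) u)"
    by (intro sum.reindex_bij_witness[of _ inverse inverse]) auto
  finally show ?thesis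
    using A B by (simp add: True sum_mult_char[OF AB])
next
  case False
  \<comment> \<open>The scaling \<open>u = w * t / x\<close> turns \<open>w - u * x\<close> into
    \<open>w * (1 - t)\<close>, so the dependence on \<open>w\<close> and \<open>x\<close> factors
    out.\<close>
  have "(\<Sum>u\<in>UNIV. B u * char_inv A (w - u * x))
      = (\<Sum>t\<in>UNIV. B (w * t / x) * char_inv A (w - (w * t / x) * x))"
    by (rule sum.reindex_bij_witness[of _ "\<lambda>t. w * t / x" "\<lambda>u. u * x / w"])
       (use x False in auto)
  also have "\<dots> = (\<Sum>t\<in>UNIV. char_inv B x * char_inv (A \<cdot> char_inv B) w * (B t * char_inv A (1 - t)))"
  proof (rule sum.cong)
    fix t
    have "w - (w * t / x) * x = w * (1 - t)"
      using x by (simp add: algebra_simps)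
    then have "char_inv A (w - (w * t / x) * x) = char_inv A w * char_inv A (1 - t)"
      by (simp add: mult_chars_mult A)
    then show "B (w * t / x) * char_inv A (w - (w * t / x) * x)
        = char_inv B x * char_inv (A \<cdot> char_inv B) w * (B t * char_inv A (1 - t))"
      by (simp add: mult_chars_mult[OF B] mult_chars_inverse[OF B] char_mult_def char_inv_def
          divide_inverse)
  qed simp
  finally show ?thesis
    using False by (simp add: jacobi_sum_def sum_distrib_left mult_ac)
qed

theorem theorem3p2:
  fixes A B B' C' :: "'a::{field,finite} \<Rightarrow> complex" and x y :: 'a
  assumes "A \<in> mult_chars" and "B \<in> mult_chars" and "B' \<in> mult_chars" and "C' \<in> mult_chars"
    and "x \<noteq> 1"
  shows "appell_F2 A B B' B C' x y =
      - triv_char x * char_inv A (1 - x) * hyp_2F1 A B' C' (y / (1 - x))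
      + char_inv B x * char_binom (A \<cdot> char_inv B) (char_inv B) * hyp_2F1 (A \<cdot> char_inv B) B' C' y
      + (of_nat CARD('a) - 1) * char_delta (A \<cdot> char_inv B) * char_inv A (- x)
          * char_inv C' y * (char_inv B' \<cdot> C') (1 - y)"
proof (cases "x = 0 \<or> y = 0")
  case True
  \<comment> \<open>Every summand on either side contains a factor that is 0 when
    \<open>x = 0\<close> or \<open>y = 0\<close>.\<close>
  then show ?thesis
    using assms by (auto simp: appell_F2_def hyp_2F1_def triv_char_def char_inv_def)
next
  case False
  then have x: "x \<noteq> 0" and y: "y \<noteq> 0"
    by auto
  note A = assms(1) and B = assms(2) and B' = assms(3) and C' = assms(4)
  have x1: "1 - x \<noteq> 0"
    using \<open>x \<noteq> 1\<close> by simp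
  \<comment> \<open>\<open>s\<close> is the sign in front of both 2F1 functions and \<open>g\<close>
    their common weight. \<open>H\<close> and \<open>K\<close> are their sums, and \<open>D\<close>
    collects what the case \<open>w = 0\<close> contributes.\<close>
  define s where "s = (B' \<cdot> C') (-1)"
  define g where "g v = B' v * (char_inv B' \<cdot> C') (1 - v)" for v
  define J where "J = char_inv B x * jacobi_sum B (char_inv A)"
  define D where "D = (of_nat CARD('a) - 1) * char_delta (A \<cdot> char_inv B) * char_inv A (- x)"
  define H where "H = (\<Sum>v\<in>UNIV. g v * char_inv (A \<cdot> char_inv B) (1 - y * v))"
  define K where "K = (\<Sum>v\<in>UNIV. g v * char_inv A (1 - y / (1 - x) * v))"

  have sign: "(B \<cdot> B' \<cdot> B \<cdot> C') (-1) = s"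
  proof -
    have "(B \<cdot> B' \<cdot> B \<cdot> C') (-1) = (B (-1) * B (-1)) * s"
      by (simp only: s_def char_mult_def mult_ac)
    then show ?thesis
      by (simp add: mult_chars_minus_one_squared[OF B])
  qed
  have inner: "(\<Sum>u\<in>UNIV. B u * (char_inv B \<cdot> B) (1 - u) * char_inv A (1 - u * x - v * y))
      = J * char_inv (A \<cdot> char_inv B) (1 - y * v) + (if v = 1 / y then D else 0)
        - char_inv A (1 - x) * char_inv A (1 - y / (1 - x) * v)" for v
  proof -
    let ?f = "\<lambda>u. B u * char_inv A ((1 - y * v) - u * x)"
    have "(\<Sum>u\<in>UNIV. B u * (char_inv B \<cdot> B) (1 - u) * char_inv A (1 - u * x - v * y))
        = (\<Sum>u\<in>UNIV - {1}. ?f u)"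
      using B by (intro sum.mono_neutral_cong_right)
        (auto simp: char_mult_def char_inv_def mult_chars_eq_0_iff algebra_simps)
    also have "\<dots> = (\<Sum>u\<in>UNIV. ?f u) - ?f 1"
      by (simp add: sum_diff1)
    also have "?f 1 = char_inv A (1 - x) * char_inv A (1 - y / (1 - x) * v)"
    proof -
      \<comment> \<open>Pulling out \<open>1 - x\<close>, which is nonzero, produces the argument
        \<open>y / (1 - x)\<close> of the first 2F1.\<close>
      have "(1 - y * v) - 1 * x = (1 - x) * (1 - y / (1 - x) * v)"
        using x1 by (simp add: right_diff_distrib)
      then show ?thesis
        using B by (simp add: mult_chars_mult[OF char_inv_mult_chars[OF A]])
    qed
    also have "1 - y * v = 0 \<longleftrightarrow> v = 1 / y"
      using y by (auto simp: field_simps)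
    then have "(\<Sum>u\<in>UNIV. ?f u)
        = J * char_inv (A \<cdot> char_inv B) (1 - y * v) + (if v = 1 / y then D else 0)"
      by (simp only: sum_affine_char[OF A B x] J_def D_def)
    finally show ?thesis .
  qed

  have "appell_F2 A B B' B C' x y = s * (\<Sum>v\<in>UNIV. \<Sum>u\<in>UNIV.
      g v * (B u * (char_inv B \<cdot> B) (1 - u) * char_inv A (1 - u * x - v * y)))"
    unfolding appell_F2_def sign
    \<comment> \<open>With \<open>v\<close> outermost, the sum over \<open>u\<close> can be
      evaluated for each fixed \<open>v\<close>.\<close>
    by (subst sum.swap) (simp add: triv_char_def x y g_def mult_ac)
  also have "\<dots> = s * (\<Sum>v\<in>UNIV. g v * (J * char_inv (A \<cdot> char_inv B) (1 - y * v)
      + (if v = 1 / y then D else 0)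
      - char_inv A (1 - x) * char_inv A (1 - y / (1 - x) * v)))"
    by (simp only: sum_distrib_left[symmetric] inner)
  also have "\<dots> = s * (\<Sum>v\<in>UNIV. J * (g v * char_inv (A \<cdot> char_inv B) (1 - y * v))
      + (if v = 1 / y then g v * D else 0)
      - char_inv A (1 - x) * (g v * char_inv A (1 - y / (1 - x) * v)))"
    by (intro arg_cong[of _ _ "(*) s"] sum.cong) (simp_all add: algebra_simps)
  also have "\<dots> = s * (J * H + g (1 / y) * D - char_inv A (1 - x) * K)"
    by (simp add: sum.distrib sum_subtractf sum_distrib_left[symmetric] H_def K_def)
  also have "\<dots> = - char_inv A (1 - x) * (s * K) + J * (s * H) + D * (s * g (1 / y))"
    by (simp add: algebra_simps)
  also have "s * K = hyp_2F1 A B' C' (y / (1 - x))"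
    using y x1 by (simp add: hyp_2F1_def K_def s_def g_def triv_char_def)
  also have "s * H = hyp_2F1 (A \<cdot> char_inv B) B' C' y"
    using y by (simp add: hyp_2F1_def H_def s_def g_def triv_char_def)
  also have "s * g (1 / y) = char_inv C' y * (char_inv B' \<cdot> C') (1 - y)"
  proof -
    have "1 - 1 / y = - ((1 - y) / y)"
      using y by (simp add: field_simps)
    then have *: "\<chi> (1 - 1 / y) = \<chi> (-1) * (\<chi> (1 - y) / \<chi> y)" if "\<chi> \<in> mult_chars" for \<chi>
      using mult_chars_minus[OF that, of "(1 - y) / y"] by (simp add: mult_chars_divide[OF that])
    \<comment> \<open>The factors are grouped so that each of the first three equals 1:
      \<open>B' (-1)\<close> and \<open>B' y\<close> cancel, while \<open>C' (-1)\<close> occurs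
      squared.\<close>
    have "s * g (1 / y) = (B' (-1) / B' (-1)) * (C' (-1) * C' (-1)) * (B' y / B' y)
        * (char_inv C' y * (char_inv B' \<cdot> C') (1 - y))"
      unfolding s_def g_def char_mult_def char_inv_def *[OF B'] *[OF C'] mult_chars_divide[OF B']
        mult_chars_one[OF B']
      by (simp only: divide_inverse inverse_mult_distrib inverse_inverse_eq mult_1_left mult_ac)
    then show ?thesis
      using y by (simp add: mult_chars_minus_one_squared[OF C'] mult_chars_eq_0_iff[OF B'])
  qed
  finally show ?thesis
    by (simp add: J_def D_def char_binom_eq_jacobi_sum[OF A B] triv_char_def x mult_ac)
qed

end
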